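(* Let $\mathcal{H}$ be a complex Hilbert space, let $A\in\mathcal{B}(\mathcal{H})$ be a positive operator, let $B=\begin{pmatrix} A & O \\ O & A \end{pmatrix}$ on $\mathcal{H}\oplus\mathcal{H}$, and let $X,Y,Z,W\in\mathcal{B}_A(\mathcal{H})$. Then $$\begin{aligned} \left\|\begin{pmatrix} X & Y \\ Z & W \end{pmatrix}\right\|_B^2\le{}&\max\{\|X\|_A^2,\|W\|_A^2\}+\max\{\|X\|_A,\|W\|_A\}\max\{\|Y\|_A,\|Z\|_A\} \\ &+\max\{\|Y\|_A^2,\|Z\|_A^2\}+w_B\begin{pmatrix} O & Z^{\sharp_A}W \\ Y^{\sharp_A}X & O \end{pmatrix}.\end{aligned}$$
   Context: $\mathcal{H}$ is a complex Hilbert space with inner product $\langle\cdot,\cdot\rangle$ (linear in the first variable), $\mathcal{B}(\mathcal{H})$ is the algebra of bounded linear operators on $\mathcal{H}$, $O$ is the zero operator, and $A\in\mathcal{B}(\mathcal{H})$ is a positive operator (i.e. $\langle Ax,x\rangle\ge 0$ for all $x$; not necessarily injective or with closed range). Put $\langle x,y\rangle_A=\langle Ax,y\rangle$ and $\|x\|_A=\sqrt{\langle x,x\rangle_A}$. An operator $R\in\mathcal{B}(\mathcal{H})$ is an $A$-adjoint of $T\in\mathcal{B}(\mathcal{H})$ if $\langle Tx,y\rangle_A=\langle x,Ry\rangle_A$ for all $x,y\in\mathcal{H}$. $\mathcal{B}_A(\mathcal{H})$ is the set of all $T\in\mathcal{B}(\mathcal{H})$ admitting an $A$-adjoint; equivalently,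 $R(T^*A)\subseteq R(A)$, where $R(\cdot)$ denotes range. For $T\in\mathcal{B}_A(\mathcal{H})$, $T^{\sharp_A}$ denotes the unique $A$-adjoint with range contained in $\overline{R(A)}$, i.e. the unique solution $S$ of $AS=T^*A$ with $R(S)\subseteq\overline{R(A)}$. For $T\in\mathcal{B}_A(\mathcal{H})$, the $A$-operator seminorm is $\|T\|_A=\sup\{\|Tx\|_A: x\in\mathcal{H},\ \|x\|_A=1\}$ and the $A$-numerical radius is $w_A(T)=\sup\{|\langle Tx,x\rangle_A|: x\in\mathcal{H},\ \|x\|_A=1\}$. The operator $B$ is positive on the Hilbert space $\mathcal{H}\oplus\mathcal{H}$, and $\langle\cdot,\cdot\rangle_B$, $\|\cdot\|_B$, $w_B(\cdot)$ are defined by the same formulas with $(\mathcal{H},A)$ replaced by $(\mathcal{H}\oplus\mathcal{H},B)$; $2\times2$ operator matrices with entries in $\mathcal{B}_A(\mathcal{H})$ act on $\mathcal{H}\oplus\mathcal{H}$ in the usual way (and belong to $\mathcal{B}_B(\mathcal{H}\oplus\mathcal{H})$). *)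

theory Defs
  imports "HOL-Analysis.Analysis"
begin

text \<open>
  Complex Hilbert spaces as a type class on top of \<^class>\<open>real_inner\<close>: the real inner product is the
  real part of the complex one, so norm and topology are those of the complex inner product.
  The complex inner product is linear in its first argument.
\<close>

class complex_inner = real_inner +
  fixes scaleC :: "complex \<Rightarrow> 'a \<Rightarrow> 'a"  (infixr \<open>*\<^sub>C\<close> 75)
    and cinner :: "'a \<Rightarrow> 'a \<Rightarrow> complex"
  assumes scaleC_add_right: "c *\<^sub>C (x + y) = c *\<^sub>C x + c *\<^sub>C y"
    and scaleC_add_left: "(c + d) *\<^sub>C x = c *\<^sub>C x + d *\<^sub>C x"
    and scaleC_scaleC: "c *\<^sub>C (d *\<^sub>C x) = (c * d) *\<^sub>C x"
    and scaleR_eq_scaleC: "r *\<^sub>R x = complex_of_real r *\<^sub>C x"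
    and cinner_commute: "cinner x y = cnj (cinner y x)"
    and cinner_add_left: "cinner (x + y) z = cinner x z + cinner y z"
    and cinner_scaleC_left: "cinner (c *\<^sub>C x) y = c * cinner x y"
    and inner_eq_Re_cinner: "inner x y = Re (cinner x y)"

class chilbert_space = complex_inner + complete_space

instantiation complex :: chilbert_space
begin
definition scaleC_complex :: "complex \<Rightarrow> complex \<Rightarrow> complex" where
  "scaleC_complex c x = c * x"
definition cinner_complex :: "complex \<Rightarrow> complex \<Rightarrow> complex" where
  "cinner_complex x y = x * cnj y"
instance
  by standard
    (auto simp: scaleC_complex_def cinner_complex_def inner_complex_def algebra_simps
      scaleR_conv_of_real)
end

instantiation prod :: (complex_inner, complex_inner) complex_inner
begin
definition scaleC_prod :: "complex \<Rightarrow> 'a \<times> 'b \<Rightarrow> 'a \<times> 'b" where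
  "scaleC_prod c x = (c *\<^sub>C fst x, c *\<^sub>C snd x)"
definition cinner_prod :: "'a \<times> 'b \<Rightarrow> 'a \<times> 'b \<Rightarrow> complex" where
  "cinner_prod x y = cinner (fst x) (fst y) + cinner (snd x) (snd y)"
instance
proof
  fix x y :: "'a \<times> 'b"
  show "cinner x y = cnj (cinner y x)"
    unfolding cinner_prod_def complex_cnj_add
    by (metis cinner_commute)
qed (auto simp: scaleC_prod_def cinner_prod_def inner_prod_def scaleC_add_right scaleC_add_left
      scaleC_scaleC scaleR_eq_scaleC cinner_add_left cinner_scaleC_left inner_eq_Re_cinner
      algebra_simps prod_eq_iff)
end

instance prod :: (chilbert_space, chilbert_space) chilbert_space ..

definition bounded_clinear :: "('a::complex_inner \<Rightarrow> 'b::complex_inner) \<Rightarrow> bool" where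
  "bounded_clinear T \<longleftrightarrow> bounded_linear T \<and> (\<forall>c x. T (c *\<^sub>C x) = c *\<^sub>C T x)"

definition positive_op :: "('a::complex_inner \<Rightarrow> 'a) \<Rightarrow> bool" where
  "positive_op A \<longleftrightarrow> bounded_clinear A \<and> (\<forall>x. cinner (A x) x \<in> \<real>\<^sub>\<ge>\<^sub>0)"

definition semi_inner :: "('a::complex_inner \<Rightarrow> 'a) \<Rightarrow> 'a \<Rightarrow> 'a \<Rightarrow> complex" where
  "semi_inner A x y = cinner (A x) y"

definition semi_norm :: "('a::complex_inner \<Rightarrow> 'a) \<Rightarrow> 'a \<Rightarrow> real" where
  "semi_norm A x = sqrt (Re (semi_inner A x x))"

definition is_A_adjoint ::
    "('a::complex_inner \<Rightarrow> 'a) \<Rightarrow> ('a \<Rightarrow> 'a) \<Rightarrow> ('a \<Rightarrow> 'a) \<Rightarrow> bool" where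
  "is_A_adjoint A T R \<longleftrightarrow>
     bounded_clinear R \<and> (\<forall>x y. semi_inner A (T x) y = semi_inner A x (R y))"

definition A_adjointable :: "('a::complex_inner \<Rightarrow> 'a) \<Rightarrow> ('a \<Rightarrow> 'a) set" where
  "A_adjointable A = {T. bounded_clinear T \<and> (\<exists>R. is_A_adjoint A T R)}"

text \<open>
  The distinguished \<open>A\<close>-adjoint; existence and uniqueness hold for positive \<open>A\<close> on a Hilbert space
  and \<open>T \<in> A_adjointable A\<close>.
\<close>

definition A_sharp :: "('a::complex_inner \<Rightarrow> 'a) \<Rightarrow> ('a \<Rightarrow> 'a) \<Rightarrow> 'a \<Rightarrow> 'a" where
  "A_sharp A T = (THE S. is_A_adjoint A T S \<and> range S \<subseteq> closure (range A))"

text \<open>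
  Both suprema are of nonnegative quantities, bounded for \<open>T \<in> A_adjointable A\<close>. Inserting \<open>0\<close> only
  matters when \<open>A = 0\<close>: the \<open>A\<close>-unit sphere is then empty and the supremum is taken to be \<open>0\<close>.
\<close>

definition A_op_seminorm :: "('a::complex_inner \<Rightarrow> 'a) \<Rightarrow> ('a \<Rightarrow> 'a) \<Rightarrow> real" where
  "A_op_seminorm A T = Sup (insert 0 {semi_norm A (T x) | x. semi_norm A x = 1})"

definition A_numerical_radius :: "('a::complex_inner \<Rightarrow> 'a) \<Rightarrow> ('a \<Rightarrow> 'a) \<Rightarrow> real" where
  "A_numerical_radius A T =
     Sup (insert 0 {cmod (semi_inner A (T x) x) | x. semi_norm A x = 1})"

definition op_matrix ::
    "('a \<Rightarrow> 'a) \<Rightarrow> ('a \<Rightarrow> 'a) \<Rightarrow> ('a \<Rightarrow> 'a) \<Rightarrow> ('a \<Rightarrow> 'a) \<Rightarrow> 'a::complex_inner \<times> 'a \<Rightarrow> 'a \<times> 'a" where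
  "op_matrix P Q R S = (\<lambda>(x, y). (P x + Q y, R x + S y))"

abbreviation zero_op :: "'a::complex_inner \<Rightarrow> 'a" where
  "zero_op \<equiv> \<lambda>_. 0"

end

theory Submission
  imports Defs
begin

text \<open>
  For a \<open>B\<close>-unit vector \<open>(x, y)\<close>, expanding the square of the \<open>B\<close>-norm of its image under the matrix
  gives diagonal terms, which are at most the two squared maxima, plus twice the real part of
  \<open>q = \<langle>Xx, Yy\<rangle>\<^sub>A + \<langle>Wy, Zx\<rangle>\<^sub>A\<close>. Moving \<open>Y\<close> and \<open>Z\<close> to the other side, \<open>q\<close> is the quadratic form of the
  off-diagonal matrix, so \<open>\<bar>q\<bar>\<close> is at most its numerical radius; by Cauchy--Schwarz, \<open>\<bar>q\<bar>\<close> is also at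
  most the product of the two maxima. One copy of \<open>\<bar>q\<bar>\<close> is estimated in each way.
\<close>

section \<open>Complex inner products\<close>

lemma cinner_add_right: "cinner x (y + z) = cinner x y + cinner x z"
  by (metis cinner_commute cinner_add_left complex_cnj_add)

lemma cinner_scaleC_right: "cinner x (c *\<^sub>C y) = cnj c * cinner x y"
  by (metis cinner_commute cinner_scaleC_left complex_cnj_mult)

lemma cinner_eqI:
  assumes "\<And>z. cinner x z = cinner y z"
  shows "x = y"
proof -
  have "inner (x - y) (x - y) = 0"
    unfolding inner_diff_left using assms[of "x - y"] by (simp only: inner_eq_Re_cinner)
  then show ?thesis by simp
qed

lemma norm_scaleC: "norm (c *\<^sub>C x) = cmod c * norm (x :: 'a::complex_inner)"
proof -
  have "cinner (c *\<^sub>C x) (c *\<^sub>C x) = c * cnj c * cinner x x"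
    by (simp add: cinner_scaleC_left cinner_scaleC_right)
  then have "inner (c *\<^sub>C x) (c *\<^sub>C x) = Re (c * cnj c * cinner x x)"
    by (simp only: inner_eq_Re_cinner)
  also have "\<dots> = (cmod c)\<^sup>2 * inner x x"
    by (simp add: complex_norm_square[symmetric] inner_eq_Re_cinner)
  finally have "(norm (c *\<^sub>C x))\<^sup>2 = (cmod c * norm x)\<^sup>2"
    by (simp add: power2_norm_eq_inner power_mult_distrib)
  then show ?thesis by (simp add: power2_eq_iff_nonneg)
qed

text \<open>Continuity of complex scaling is what later makes the closure of the range of
  \<open>A\<close> stable under complex, not only real, scalars.\<close>

lemma bounded_linear_scaleC: "bounded_linear (\<lambda>x::'a::complex_inner. c *\<^sub>C x)"
proof (rule bounded_linear_intro)
  show "c *\<^sub>C (r *\<^sub>R x) = r *\<^sub>R (c *\<^sub>C x)" for r and x :: 'a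
    by (simp add: scaleR_eq_scaleC scaleC_scaleC mult.commute)
  show "norm (c *\<^sub>C x) \<le> norm x * cmod c" for x :: 'a
    by (simp add: norm_scaleC mult.commute)
qed (simp add: scaleC_add_right)

section \<open>Orthogonal projection onto a closed subspace\<close>

text \<open>A minimizing sequence for the distance from \<open>y\<close> to \<open>M\<close> is
  Cauchy by the parallelogram law; its limit \<open>p\<close> is a nearest point, and minimality
  along each line through \<open>p\<close> in \<open>M\<close> gives orthogonality.\<close>

lemma orthogonal_decomposition_closed_subspace:
  fixes M :: "'a::{real_inner, complete_space} set"
  assumes "subspace M" and "closed M"
  obtains p where "p \<in> M" and "\<And>m. m \<in> M \<Longrightarrow> inner (y - p) m = 0"
proof -
  have ne: "M \<noteq> {}" using subspace_0[OF assms(1)] by auto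
  define d where "d = infdist y M"
  have d0: "0 \<le> d" by (simp add: d_def infdist_nonneg)
  have dle: "d \<le> norm (y - m)" if "m \<in> M" for m
    using infdist_le[OF that, of y] by (simp add: d_def dist_norm)
  have "\<exists>m\<in>M. norm (y - m) < d + e" if "e > 0" for e
  proof -
    have "d + e \<le> infdist y M" if "\<forall>m\<in>M. d + e \<le> norm (y - m)"
      using that ne by (auto simp: infdist_def dist_norm intro!: cINF_greatest)
    with \<open>e > 0\<close> show ?thesis by (force simp: d_def not_less[symmetric])
  qed
  then have "\<forall>n. \<exists>m\<in>M. norm (y - m) < d + 1 / real (Suc n)" by simp
  then obtain f where fM: "\<And>n. f n \<in> M" and f: "\<And>n. norm (y - f n) < d + 1 / real (Suc n)"
    by metis
  \<comment> \<open>Parallelogram law for \<open>y - a\<close> and \<open>y - b\<close>: the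
    midpoint of \<open>a\<close> and \<open>b\<close> lies in \<open>M\<close>, so its distance to
    \<open>y\<close> is at least \<open>d\<close>.\<close>
  have par: "(norm (a - b))\<^sup>2 \<le> 4 * ((d + e)\<^sup>2 - d\<^sup>2)"
    if "a \<in> M" "b \<in> M" "norm (y - a) \<le> d + e" "norm (y - b) \<le> d + e" for a b e
  proof -
    have "(norm (a - b))\<^sup>2 = 2 * (norm (y - a))\<^sup>2 + 2 * (norm (y - b))\<^sup>2
        - 4 * (norm (y - (1/2) *\<^sub>R (a + b)))\<^sup>2"
      unfolding power2_norm_eq_inner
      by (simp add: inner_add_left inner_add_right inner_diff_left inner_diff_right
          inner_commute algebra_simps)
    moreover have "(1/2) *\<^sub>R (a + b) \<in> M"
      using that assms(1) by (simp add: subspace_add subspace_scale)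
    then have "d\<^sup>2 \<le> (norm (y - (1/2) *\<^sub>R (a + b)))\<^sup>2"
      using dle d0 by (intro power_mono) auto
    moreover have "(norm (y - a))\<^sup>2 \<le> (d + e)\<^sup>2" "(norm (y - b))\<^sup>2 \<le> (d + e)\<^sup>2"
      using that by (auto intro!: power_mono)
    ultimately show ?thesis by (simp add: right_diff_distrib)
  qed
  have "Cauchy f"
  proof (rule metric_CauchyI)
    fix e :: real assume "e > 0"
    have "(\<lambda>n. 4 * ((d + 1 / real (Suc n))\<^sup>2 - d\<^sup>2)) \<longlonglongrightarrow> 4 * ((d + 0)\<^sup>2 - d\<^sup>2)"
      by (intro tendsto_intros LIMSEQ_inverse_real_of_nat[unfolded inverse_eq_divide])
    then have "\<forall>\<^sub>F n in sequentially. 4 * ((d + 1 / real (Suc n))\<^sup>2 - d\<^sup>2) < e\<^sup>2"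
      using \<open>e > 0\<close> by (intro order_tendstoD(2)) auto
    then obtain N where N: "4 * ((d + 1 / real (Suc N))\<^sup>2 - d\<^sup>2) < e\<^sup>2"
      by (auto simp: eventually_sequentially)
    have le: "norm (y - f n) \<le> d + 1 / real (Suc N)" if "n \<ge> N" for n
    proof -
      have "1 / real (Suc n) \<le> 1 / real (Suc N)" using that by (simp add: frac_le)
      with f[of n] show ?thesis by linarith
    qed
    show "\<exists>N. \<forall>m\<ge>N. \<forall>n\<ge>N. dist (f m) (f n) < e"
    proof (intro exI allI impI)
      fix m n assume "m \<ge> N" "n \<ge> N"
      then have "(norm (f m - f n))\<^sup>2 < e\<^sup>2"
        using par[OF fM fM le le] N by (meson order_le_less_trans)
      then show "dist (f m) (f n) < e"
        using \<open>e > 0\<close> power2_less_imp_less[of "norm (f m - f n)" e] by (simp add: dist_norm)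
    qed
  qed
  then obtain p where lim: "f \<longlonglongrightarrow> p"
    using Cauchy_convergent_iff convergent_def by blast
  have pM: "p \<in> M" using closed_sequentially[OF assms(2) _ lim] fM by blast
  have "(\<lambda>n. d + 1 / real (Suc n)) \<longlonglongrightarrow> d + 0"
    by (intro tendsto_intros LIMSEQ_inverse_real_of_nat[unfolded inverse_eq_divide])
  then have "norm (y - p) \<le> d + 0"
    using f by (intro LIMSEQ_le[of "\<lambda>n. norm (y - f n)"])
      (auto intro!: tendsto_intros lim intro: less_imp_le)
  then have pd: "norm (y - p) \<le> d" by simp
  have "inner (y - p) m = 0" if "m \<in> M" for m
  proof (cases "m = 0")
    case False
    \<comment> \<open>The minimizer of the squared distance from \<open>y\<close> to
      \<open>p + t m\<close>, a quadratic in \<open>t\<close>.\<close>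
    define t where "t = inner (y - p) m / inner m m"
    have "p + t *\<^sub>R m \<in> M" using pM that assms(1) by (simp add: subspace_add subspace_scale)
    then have "norm (y - p) \<le> norm (y - (p + t *\<^sub>R m))" using dle pd by fastforce
    then have "(norm (y - p))\<^sup>2 \<le> (norm ((y - p) - t *\<^sub>R m))\<^sup>2"
      by (intro power_mono) (auto simp: algebra_simps)
    also have "\<dots> = (norm (y - p))\<^sup>2 - 2 * t * inner (y - p) m + t * t * inner m m"
      unfolding power2_norm_eq_inner inner_diff_left[of "y - p"] inner_diff_right[of _ "y - p"]
      by (simp add: inner_commute[of m "y - p"])
    also have "\<dots> = (norm (y - p))\<^sup>2 - (inner (y - p) m)\<^sup>2 / inner m m"
      using False by (simp add: t_def field_simps power2_eq_square)
    finally have "(inner (y - p) m)\<^sup>2 / inner m m \<le> 0" by simp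
    with False show ?thesis
      by (smt (verit) divide_pos_pos inner_gt_zero_iff zero_less_power2)
  qed simp
  with pM show ?thesis using that by blast
qed

section \<open>The semi-inner product of a positive operator\<close>

lemma bounded_clinear_add: "bounded_clinear T \<Longrightarrow> T (x + y) = T x + T y"
  by (simp add: bounded_clinear_def linear_simps)

lemma bounded_clinear_diff: "bounded_clinear T \<Longrightarrow> T (x - y) = T x - T y"
  by (simp add: bounded_clinear_def linear_simps)

lemma bounded_clinear_scaleR: "bounded_clinear T \<Longrightarrow> T (r *\<^sub>R x) = r *\<^sub>R T x"
  by (simp add: bounded_clinear_def linear_simps)

lemma bounded_clinear_scaleC: "bounded_clinear T \<Longrightarrow> T (c *\<^sub>C x) = c *\<^sub>C T x"
  by (simp add: bounded_clinear_def)

context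
  fixes A :: "'a::complex_inner \<Rightarrow> 'a"
  assumes pos: "positive_op A"
begin

lemma positive_op_clinear: "bounded_clinear A"
  using pos by (simp add: positive_op_def)

lemmas A_add = bounded_clinear_add[OF positive_op_clinear]
lemmas A_scaleC = bounded_clinear_scaleC[OF positive_op_clinear]

lemma semi_inner_add_left: "semi_inner A (x + y) z = semi_inner A x z + semi_inner A y z"
  by (simp add: semi_inner_def A_add cinner_add_left)

lemma semi_inner_add_right: "semi_inner A x (y + z) = semi_inner A x y + semi_inner A x z"
  by (simp add: semi_inner_def cinner_add_right)

lemma semi_inner_scaleC_left: "semi_inner A (c *\<^sub>C x) y = c * semi_inner A x y"
  by (simp add: semi_inner_def A_scaleC cinner_scaleC_left)

lemma semi_inner_scaleC_right: "semi_inner A x (c *\<^sub>C y) = cnj c * semi_inner A x y"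
  by (simp add: semi_inner_def cinner_scaleC_right)

lemma semi_inner_self: "Im (semi_inner A x x) = 0" "0 \<le> Re (semi_inner A x x)"
  using pos by (auto simp: positive_op_def semi_inner_def complex_nonneg_Reals_iff)

text \<open>Polarization: the diagonal of the form is real at \<open>x + y\<close> and at \<open>\<i>x + y\<close>.\<close>

lemma semi_inner_commute: "semi_inner A x y = cnj (semi_inner A y x)"
proof -
  have "Im (semi_inner A (x + y) (x + y)) = 0"
    "Im (semi_inner A (\<i> *\<^sub>C x + y) (\<i> *\<^sub>C x + y)) = 0"
    by (rule semi_inner_self)+
  then show ?thesis
    using semi_inner_self(1)[of x] semi_inner_self(1)[of y]
    by (simp add: semi_inner_add_left semi_inner_add_right semi_inner_scaleC_left
        semi_inner_scaleC_right complex_eq_iff)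
qed

text \<open>Hermitian symmetry of the form says that \<open>A\<close> is selfadjoint.\<close>

lemma cinner_positive_op_commute: "cinner (A x) y = cinner x (A y)"
  using semi_inner_commute[of x y] cinner_commute[of x "A y"] by (simp add: semi_inner_def)

lemma semi_norm_nonneg [simp]: "0 \<le> semi_norm A x"
  by (simp add: semi_norm_def semi_inner_self)

lemma semi_norm_power2: "(semi_norm A x)\<^sup>2 = Re (semi_inner A x x)"
  by (simp add: semi_norm_def semi_inner_self)

lemma semi_norm_scaleC: "semi_norm A (c *\<^sub>C x) = cmod c * semi_norm A x"
proof -
  have "semi_inner A (c *\<^sub>C x) (c *\<^sub>C x) = (c * cnj c) * semi_inner A x x"
    by (simp add: semi_inner_scaleC_left semi_inner_scaleC_right)
  then have "(semi_norm A (c *\<^sub>C x))\<^sup>2 = (cmod c * semi_norm A x)\<^sup>2"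
    by (simp add: semi_norm_power2 power_mult_distrib flip: complex_norm_square)
  then show ?thesis by (simp add: power2_eq_iff_nonneg)
qed

lemma semi_norm_scaleR: "semi_norm A (r *\<^sub>R x) = \<bar>r\<bar> * semi_norm A x"
  by (simp add: scaleR_eq_scaleC semi_norm_scaleC)

lemma semi_norm_add_power2:
  "(semi_norm A (x + y))\<^sup>2
    = (semi_norm A x)\<^sup>2 + (semi_norm A y)\<^sup>2 + 2 * Re (semi_inner A x y)"
  using semi_inner_commute[of x y]
  by (simp add: semi_norm_power2 semi_inner_add_left semi_inner_add_right)

text \<open>The squared seminorm of \<open>x + t y\<close> is a nonnegative quadratic in real
  \<open>t\<close>. Since \<open>y\<close> may be a nonzero null vector of the form, the case of
  vanishing leading coefficient is separate.\<close>

lemma Re_semi_inner_le: "Re (semi_inner A x y) \<le> semi_norm A x * semi_norm A y"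
proof -
  define a b c where "a = semi_norm A x" and "b = semi_norm A y" and "c = Re (semi_inner A x y)"
  have nn: "0 \<le> a\<^sup>2 + t\<^sup>2 * b\<^sup>2 + 2 * t * c" for t
  proof -
    have "Re (semi_inner A x (t *\<^sub>R y)) = t * c"
      by (simp add: c_def scaleR_eq_scaleC semi_inner_scaleC_right)
    then have "(semi_norm A (x + t *\<^sub>R y))\<^sup>2 = a\<^sup>2 + t\<^sup>2 * b\<^sup>2 + 2 * t * c"
      by (simp add: semi_norm_add_power2 semi_norm_scaleR a_def b_def power_mult_distrib)
    then show ?thesis by (metis zero_le_power2)
  qed
  have ab: "0 \<le> a" "0 \<le> b" by (auto simp: a_def b_def)
  have "c \<le> a * b"
  proof (cases "b = 0")
    case True
    show ?thesis
    proof (rule ccontr)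
      assume "\<not> ?thesis"
      then have "c > 0" using True by simp
      \<comment> \<open>With \<open>b = 0\<close> the quadratic is affine in \<open>t\<close>; at
        this \<open>t\<close> its value is \<open>-1\<close>.\<close>
      then show False using nn[of "- (a\<^sup>2 + 1) / (2 * c)"] True by (simp add: field_simps)
    qed
  next
    case False
    \<comment> \<open>The quadratic attains its minimum at \<open>t = - c / b^2\<close>.\<close>
    have "(- c / b\<^sup>2)\<^sup>2 * b\<^sup>2 = c\<^sup>2 / b\<^sup>2" using False by (simp add: power2_eq_square)
    moreover have "2 * (- c / b\<^sup>2) * c = - 2 * (c\<^sup>2 / b\<^sup>2)" by (simp add: power2_eq_square)
    ultimately have "0 \<le> a\<^sup>2 - c\<^sup>2 / b\<^sup>2" using nn[of "- c / b\<^sup>2"] by linarith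
    then have "c\<^sup>2 \<le> (a * b)\<^sup>2" using False by (simp add: field_simps power_mult_distrib)
    then show ?thesis using ab by (intro power2_le_imp_le[of c "a * b"]) auto
  qed
  then show ?thesis by (simp add: a_def b_def c_def)
qed

lemma cmod_semi_inner_le: "cmod (semi_inner A x y) \<le> semi_norm A x * semi_norm A y"
proof (cases "semi_inner A x y = 0")
  case False
  define z where "z = semi_inner A x y"
  \<comment> \<open>The phase that rotates the product to its modulus, so that the bound on real
    parts applies.\<close>
  define c where "c = cnj z / cmod z"
  have z: "z \<noteq> 0" using False by (simp add: z_def)
  have "cmod c = 1" using z by (simp add: c_def norm_divide)
  moreover have "semi_inner A (c *\<^sub>C x) y = cmod z"
    using z complex_norm_square[of z]
    by (simp add: semi_inner_scaleC_left c_def power2_eq_square field_simps flip: z_def)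
  ultimately show ?thesis
    using Re_semi_inner_le[of "c *\<^sub>C x" y] by (simp add: semi_norm_scaleC z_def)
qed simp

text \<open>Converts exponential growth of the norms of iterates into exponential growth of their
  seminorms.\<close>

lemma semi_norm_le_norm: "\<exists>C. \<forall>x. semi_norm A x \<le> C * norm x"
proof -
  obtain K where K: "\<And>x. norm (A x) \<le> norm x * K" "0 \<le> K"
    using positive_op_clinear bounded_linear.nonneg_bounded unfolding bounded_clinear_def by blast
  have "semi_norm A x \<le> sqrt K * norm x" for x
  proof -
    have "(semi_norm A x)\<^sup>2 = inner (A x) x"
      by (simp add: semi_norm_power2 semi_inner_def inner_eq_Re_cinner)
    also have "\<dots> \<le> norm (A x) * norm x" by (rule norm_cauchy_schwarz)
    also have "\<dots> \<le> norm x * K * norm x" using K by (intro mult_right_mono) auto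
    also have "\<dots> = (sqrt K * norm x)\<^sup>2" using K by (simp add: power2_eq_square ac_simps)
    finally show ?thesis by (rule power2_le_imp_le) (use K in simp)
  qed
  then show ?thesis by blast
qed

end

section \<open>Operators with an adjoint are bounded for the seminorm\<close>

text \<open>If the first two terms are nonzero, log-convexity makes the ratios of consecutive terms
  nondecreasing, so the sequence dominates \<open>a 0 * r ^ n\<close> with \<open>r\<close> the
  first ratio. Growth bounded by \<open>C * K ^ n\<close> then excludes
  \<open>r > K\<close>.\<close>

lemma log_convex_first_ratio_le:
  fixes a :: "nat \<Rightarrow> real"
  assumes nn: "\<And>n. 0 \<le> a n" and lc: "\<And>n. (a (Suc n))\<^sup>2 \<le> a n * a (Suc (Suc n))"
    and bd: "\<And>n. a n \<le> C * K ^ n" and K: "K > 0"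
  shows "a 1 \<le> K * a 0"
proof (cases "a 0 = 0 \<or> a 1 = 0")
  case True
  then show ?thesis
  proof
    assume "a 0 = 0"
    then have "(a 1)\<^sup>2 \<le> 0" using lc[of 0] by simp
    then show ?thesis using \<open>a 0 = 0\<close> by simp
  qed (use nn K in auto)
next
  case False
  define r where "r = a 1 / a 0"
  have a0: "a 0 > 0" and r0: "r > 0"
    using False nn[of 0] nn[of 1] by (auto simp: r_def less_le)
  have step: "a n > 0 \<and> r * a n \<le> a (Suc n)" for n
  proof (induction n)
    case 0
    then show ?case using a0 by (simp add: r_def)
  next
    case (Suc n)
    have p: "a (Suc n) > 0" using Suc r0 by (smt (verit) mult_pos_pos)
    \<comment> \<open>Log-convexity is applied after multiplying by the positive \<open>a n\<close>,
      which is cancelled at the end.\<close>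
    have "(r * a (Suc n)) * a n \<le> a (Suc n) * a (Suc n)"
      using Suc p by (simp add: mult.commute mult.left_commute)
    also have "\<dots> \<le> a (Suc (Suc n)) * a n" using lc[of n] by (simp add: power2_eq_square mult.commute)
    finally show ?case using p Suc by simp
  qed
  have geo: "a 0 * r ^ n \<le> a n" for n
  proof (induction n)
    case (Suc n)
    have "a 0 * r ^ Suc n = r * (a 0 * r ^ n)" by simp
    also have "\<dots> \<le> r * a n" using Suc r0 by simp
    also have "\<dots> \<le> a (Suc n)" using step by simp
    finally show ?case .
  qed simp
  have "r \<le> K"
  proof (rule ccontr)
    assume "\<not> r \<le> K"
    then have "1 < r / K" using K by simp
    then obtain n where n: "C / a 0 < (r / K) ^ n" using real_arch_pow by blast
    have "a 0 * r ^ n \<le> C * K ^ n" using geo bd order_trans by blast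
    then have "(r / K) ^ n \<le> C / a 0" using a0 K by (simp add: field_simps power_divide)
    with n show False by simp
  qed
  then show ?thesis using a0 by (simp add: r_def field_simps)
qed

text \<open>Krein's argument: the seminorms of the iterates of an \<open>A\<close>-selfadjoint operator form a
  log-convex sequence of at most exponential growth.\<close>

lemma A_selfadjoint_semi_norm_bounded:
  fixes A :: "'a::complex_inner \<Rightarrow> 'a"
  assumes pos: "positive_op A" and lin: "bounded_clinear S"
    and sa: "\<And>x y. semi_inner A (S x) y = semi_inner A x (S y)"
  obtains K where "K > 0" and "\<And>x. semi_norm A (S x) \<le> K * semi_norm A x"
proof -
  obtain C where C: "\<And>x. semi_norm A x \<le> C * norm x" using semi_norm_le_norm[OF pos] by blast
  obtain K where K: "\<And>x. norm (S x) \<le> norm x * K" "0 < K"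
    using lin bounded_linear.pos_bounded unfolding bounded_clinear_def by blast
  have "semi_norm A (S x) \<le> K * semi_norm A x" for x
  proof -
    define a where "a n = semi_norm A ((S ^^ n) x)" for n
    have "a 1 \<le> K * a 0"
    \<comment> \<open>Nothing guarantees that \<open>C\<close> is nonnegative; the absolute value
      keeps the products monotone. The rate \<open>K\<close> is the norm bound of \<open>S\<close>,
      independent of \<open>x\<close>.\<close>
    proof (rule log_convex_first_ratio_le[where C = "\<bar>C\<bar> * norm x"])
      show "0 \<le> a n" for n by (simp add: a_def semi_norm_nonneg[OF pos])
      \<comment> \<open>Selfadjointness moves one \<open>S\<close> across, so the square of the
        middle term is the product of the outer iterates, bounded by Cauchy-Schwarz.\<close>
      show "(a (Suc n))\<^sup>2 \<le> a n * a (Suc (Suc n))" for n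
        using Re_semi_inner_le[OF pos, of "(S ^^ n) x" "S (S ((S ^^ n) x))"]
        by (simp add: a_def semi_norm_power2[OF pos] sa)
      have it: "norm ((S ^^ n) x) \<le> norm x * K ^ n" for n
      proof (induction n)
        case (Suc n)
        have "norm ((S ^^ Suc n) x) \<le> norm ((S ^^ n) x) * K" using K by simp
        also have "\<dots> \<le> norm x * K ^ n * K" using Suc K by (intro mult_right_mono) auto
        finally show ?case by (simp add: ac_simps)
      qed simp
      show "a n \<le> \<bar>C\<bar> * norm x * K ^ n" for n
      proof -
        have "a n \<le> C * norm ((S ^^ n) x)" by (simp add: a_def C)
        also have "\<dots> \<le> \<bar>C\<bar> * (norm x * K ^ n)"
          by (intro mult_mono it) auto
        finally show ?thesis by (simp add: ac_simps)
      qed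
    qed (fact K)
    then show ?thesis by (simp add: a_def)
  qed
  with K that show ?thesis by blast
qed

lemma bounded_clinear_comp:
  "bounded_clinear S \<Longrightarrow> bounded_clinear T \<Longrightarrow> bounded_clinear (\<lambda>x. S (T x))"
  by (auto simp: bounded_clinear_def intro: bounded_linear_compose)

text \<open>For an adjoint \<open>R\<close>, the composition of \<open>R\<close> after
  \<open>T\<close> is selfadjoint for the form, hence bounded by some \<open>K\<close>. The squared
  seminorm of \<open>T x\<close> is the product of \<open>x\<close> with \<open>R (T x)\<close>,
  which gives the constant \<open>sqrt K\<close>.\<close>

lemma A_adjointable_semi_norm_bounded:
  fixes A :: "'a::complex_inner \<Rightarrow> 'a"
  assumes pos: "positive_op A" and T: "T \<in> A_adjointable A"
  obtains K where "\<And>x. semi_norm A (T x) \<le> K * semi_norm A x"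
proof -
  obtain R where lT: "bounded_clinear T" and lR: "bounded_clinear R"
    and R: "\<And>x y. semi_inner A (T x) y = semi_inner A x (R y)"
    using T by (auto simp: A_adjointable_def is_A_adjoint_def)
  have "semi_inner A (R (T x)) y = semi_inner A x (R (T y))" for x y
    by (metis R semi_inner_commute[OF pos])
  then obtain K where K: "K > 0" "\<And>x. semi_norm A (R (T x)) \<le> K * semi_norm A x"
    using A_selfadjoint_semi_norm_bounded[OF pos bounded_clinear_comp[OF lR lT]] by blast
  have "semi_norm A (T x) \<le> sqrt K * semi_norm A x" for x
  proof -
    have "(semi_norm A (T x))\<^sup>2 = Re (semi_inner A x (R (T x)))"
      by (simp add: semi_norm_power2[OF pos] R)
    also have "\<dots> \<le> semi_norm A x * semi_norm A (R (T x))" by (rule Re_semi_inner_le[OF pos])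
    also have "\<dots> \<le> semi_norm A x * (K * semi_norm A x)"
      using K semi_norm_nonneg[OF pos] by (intro mult_left_mono) auto
    also have "\<dots> = (sqrt K * semi_norm A x)\<^sup>2" using K by (simp add: power2_eq_square)
    finally show ?thesis
      by (rule power2_le_imp_le) (use K semi_norm_nonneg[OF pos] in simp)
  qed
  then show ?thesis using that by blast
qed

text \<open>Boundedness makes the supremum an actual upper bound, and rescaling extends it from unit
  vectors to vectors of nonzero seminorm.\<close>

lemma
  fixes A :: "'a::complex_inner \<Rightarrow> 'a"
  assumes pos: "positive_op A" and T: "T \<in> A_adjointable A"
  shows A_op_seminorm_nonneg: "0 \<le> A_op_seminorm A T"
    and semi_norm_le_A_op_seminorm: "semi_norm A (T x) \<le> A_op_seminorm A T * semi_norm A x"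
proof -
  obtain K where K: "\<And>x. semi_norm A (T x) \<le> K * semi_norm A x"
    using A_adjointable_semi_norm_bounded[OF pos T] by blast
  have lT: "bounded_clinear T" using T by (simp add: A_adjointable_def)
  let ?D = "insert 0 {semi_norm A (T x) | x. semi_norm A x = 1}"
  have bdd: "bdd_above ?D"
  proof (rule bdd_aboveI)
    fix u assume "u \<in> ?D"
    \<comment> \<open>The \<open>0\<close> accounts for the element inserted into the set.\<close>
    then show "u \<le> max 0 K"
    proof
      assume "u \<in> {semi_norm A (T x) | x. semi_norm A x = 1}"
      then obtain x where "u = semi_norm A (T x)" "semi_norm A x = 1" by blast
      then show ?thesis using K[of x] by simp
    qed simp
  qed
  show "0 \<le> A_op_seminorm A T"
    unfolding A_op_seminorm_def using bdd by (intro cSup_upper) auto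
  show "semi_norm A (T x) \<le> A_op_seminorm A T * semi_norm A x"
  proof (cases "semi_norm A x = 0")
    case True
    \<comment> \<open>The supremum says nothing about null vectors of the form; the bound
      \<open>K\<close> shows that \<open>T\<close> maps them to null vectors.\<close>
    then show ?thesis using K[of x] by simp
  next
    case False
    then have s: "semi_norm A x > 0" using semi_norm_nonneg[OF pos, of x] by simp
    define u where "u = (1 / semi_norm A x) *\<^sub>R x"
    have "semi_norm A u = 1" using s by (simp add: u_def semi_norm_scaleR[OF pos])
    then have "semi_norm A (T u) \<le> A_op_seminorm A T"
      unfolding A_op_seminorm_def using bdd by (intro cSup_upper) auto
    moreover have "semi_norm A (T u) = semi_norm A (T x) / semi_norm A x"
      using s by (simp add: u_def bounded_clinear_scaleR[OF lT] semi_norm_scaleR[OF pos])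
    ultimately show ?thesis using s by (simp add: field_simps)
  qed
qed

section \<open>The distinguished adjoint\<close>

lemma subspace_closure:
  fixes S :: "'a::real_normed_vector set"
  assumes "subspace S"
  shows "subspace (closure S)"
proof (rule subspaceI)
  show "0 \<in> closure S" using subspace_0[OF assms] closure_subset by blast
next
  fix x y assume "x \<in> closure S" "y \<in> closure S"
  then obtain f g where "\<forall>n. f n \<in> S" "f \<longlonglongrightarrow> x" "\<forall>n. g n \<in> S" "g \<longlonglongrightarrow> y"
    unfolding closure_sequential by blast
  then show "x + y \<in> closure S"
    unfolding closure_sequential using assms
    by (intro exI[of _ "\<lambda>n. f n + g n"]) (auto intro: tendsto_add subspace_add)
next
  fix c and x assume "x \<in> closure S"
  then obtain f where "\<forall>n. f n \<in> S" "f \<longlonglongrightarrow> x"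
    unfolding closure_sequential by blast
  then show "c *\<^sub>R x \<in> closure S"
    unfolding closure_sequential using assms
    by (intro exI[of _ "\<lambda>n. c *\<^sub>R f n"]) (auto intro: tendsto_scaleR subspace_scale)
qed

text \<open>Selfadjointness makes a kernel vector orthogonal to the range, by continuity to its
  closure, and so to itself. Uniqueness of the distinguished adjoint rests on this.\<close>

lemma kernel_Int_closure_range:
  fixes A :: "'a::complex_inner \<Rightarrow> 'a"
  assumes pos: "positive_op A" and "A v = 0" and "v \<in> closure (range A)"
  shows "v = 0"
proof -
  have "inner (A x) v = 0" for x
    using assms(2) cinner_positive_op_commute[OF pos, of x v]
    by (metis inner_eq_Re_cinner inner_zero_right)
  moreover have "closed {u. inner u v = 0}"
    by (intro closed_Collect_eq continuous_intros)
  ultimately have "closure (range A) \<subseteq> {u. inner u v = 0}"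
    by (intro closure_minimal) auto
  then show ?thesis using assms(3) by auto
qed

text \<open>To resolve the \<open>THE\<close>, any adjoint \<open>R\<close> is followed by the
  orthogonal projection \<open>P\<close> onto the closed range. This keeps it an adjoint because
  \<open>A (P y) = A y\<close>; uniqueness holds because \<open>A\<close> is injective on the closed
  range.\<close>

lemma A_sharp_is_A_adjoint:
  fixes A :: "'a::chilbert_space \<Rightarrow> 'a"
  assumes pos: "positive_op A" and T: "T \<in> A_adjointable A"
  shows "is_A_adjoint A T (A_sharp A T)"
proof -
  let ?M = "closure (range A)"
  note lA = positive_op_clinear[OF pos]
  have linA: "linear A"
    using lA by (simp add: bounded_clinear_def bounded_linear.linear)
  have sub: "subspace ?M"
    using linear_subspace_image[OF linA subspace_UNIV] by (rule subspace_closure)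
  have scale: "c *\<^sub>C v \<in> ?M" if "v \<in> ?M" for c v
  proof -
    have "(\<lambda>x. c *\<^sub>C x) ` ?M \<subseteq> closure ((\<lambda>x. c *\<^sub>C x) ` range A)"
      by (intro closure_bounded_linear_image_subset bounded_linear_scaleC)
    also have "\<dots> \<subseteq> ?M"
      by (intro closure_mono) (auto simp flip: bounded_clinear_scaleC[OF lA])
    finally show ?thesis using that by blast
  qed
  have "\<exists>p. p \<in> ?M \<and> A p = A y \<and> norm p \<le> norm y" for y
  proof -
    obtain p where p: "p \<in> ?M" and orth: "\<And>m. m \<in> ?M \<Longrightarrow> inner (y - p) m = 0"
      using orthogonal_decomposition_closed_subspace[OF sub closed_closure] by blast
    \<comment> \<open>Testing orthogonality against this vector and moving one \<open>A\<close>
      across makes the norm of \<open>A (y - p)\<close> vanish.\<close>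
    have "inner (y - p) (A (A (y - p))) = 0"
      using orth closure_subset by blast
    then have "inner (A (y - p)) (A (y - p)) = 0"
      by (simp add: inner_eq_Re_cinner cinner_positive_op_commute[OF pos])
    then have "A p = A y" by (simp add: bounded_clinear_diff[OF lA])
    moreover have "inner y p = inner p p" using orth[OF p] by (simp add: inner_diff_left)
    then have "norm p * norm p \<le> norm y * norm p"
      by (metis norm_cauchy_schwarz power2_eq_square power2_norm_eq_inner)
    then have "norm p \<le> norm y"
      by (cases "p = 0") (auto simp: mult_le_cancel_right)
    ultimately show ?thesis using p by blast
  qed
  then obtain P where PM: "\<And>y. P y \<in> ?M" and AP: "\<And>y. A (P y) = A y"
    and Pn: "\<And>y. norm (P y) \<le> norm y" by metis
  \<comment> \<open>Vectors of the closed range are determined by their images under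
    \<open>A\<close>; linearity of \<open>P\<close> follows by comparing such images.\<close>
  have uniq: "u = v" if "u \<in> ?M" "v \<in> ?M" "A u = A v" for u v
    using kernel_Int_closure_range[OF pos, of "u - v"] that subspace_diff[OF sub]
    by (simp add: bounded_clinear_diff[OF lA])
  have "P (x + y) = P x + P y" for x y
    by (rule uniq) (simp_all add: PM AP subspace_add[OF sub] bounded_clinear_add[OF lA])
  moreover have "P (r *\<^sub>R x) = r *\<^sub>R P x" for r x
    by (rule uniq) (simp_all add: PM AP subspace_scale[OF sub] bounded_clinear_scaleR[OF lA])
  ultimately have "bounded_linear P"
    using Pn by (intro bounded_linear_intro[where K = 1]) auto
  moreover have "P (c *\<^sub>C x) = c *\<^sub>C P x" for c x
    by (rule uniq) (simp_all add: PM AP scale bounded_clinear_scaleC[OF lA])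
  ultimately have lP: "bounded_clinear P" by (simp add: bounded_clinear_def)
  obtain R where lR: "bounded_clinear R"
    and R: "\<And>x y. semi_inner A (T x) y = semi_inner A x (R y)"
    using T by (auto simp: A_adjointable_def is_A_adjoint_def)
  \<comment> \<open>All adjoints of \<open>T\<close> agree after applying \<open>A\<close>.\<close>
  have AR: "A (S y) = A (R y)" if "is_A_adjoint A T S" for S y
  proof (rule cinner_eqI)
    fix z
    have "cinner (A z) (S y) = cinner (A z) (R y)"
      using that R by (simp add: is_A_adjoint_def semi_inner_def)
    then show "cinner (A (S y)) z = cinner (A (R y)) z"
      by (metis cinner_commute cinner_positive_op_commute[OF pos])
  qed
  have ex: "is_A_adjoint A T (\<lambda>y. P (R y)) \<and> range (\<lambda>y. P (R y)) \<subseteq> ?M"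
    using bounded_clinear_comp[OF lP lR] PM
    by (auto simp: is_A_adjoint_def R)
      (simp add: semi_inner_def cinner_positive_op_commute[OF pos] AP)
  have eq: "S = (\<lambda>y. P (R y))" if S: "is_A_adjoint A T S" "range S \<subseteq> ?M" for S
  proof
    fix y
    show "S y = P (R y)"
    proof (rule uniq)
      show "A (S y) = A (P (R y))" by (simp only: AR[OF S(1)] AP)
      show "S y \<in> ?M" using S(2) by blast
    qed (fact PM)
  qed
  have "\<exists>!S. is_A_adjoint A T S \<and> range S \<subseteq> ?M"
    using ex eq by (intro ex1I[where a = "\<lambda>y. P (R y)"]) simp_all
  then show ?thesis unfolding A_sharp_def by (rule theI'[THEN conjunct1])
qed

section \<open>Operator matrices\<close>

lemma semi_inner_op_matrix_diag:
  "semi_inner (op_matrix A zero_op zero_op A) u v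
    = semi_inner A (fst u) (fst v) + semi_inner A (snd u) (snd v)"
  by (simp add: semi_inner_def op_matrix_def cinner_prod_def split_beta)

lemma semi_norm_op_matrix_diag_power2:
  assumes "positive_op A"
  shows "(semi_norm (op_matrix A zero_op zero_op A) u)\<^sup>2
    = (semi_norm A (fst u))\<^sup>2 + (semi_norm A (snd u))\<^sup>2"
  using semi_inner_self[OF assms]
  by (simp add: semi_norm_def semi_inner_op_matrix_diag)

section \<open>Elementary real inequalities\<close>

lemma power2_max:
  fixes a b :: real
  assumes "0 \<le> a" "0 \<le> b"
  shows "(max a b)\<^sup>2 = max (a\<^sup>2) (b\<^sup>2)"
  using assms by (simp add: max_def)

text \<open>Two operators act on separate components, of lengths \<open>x\<close> and
  \<open>y\<close>, of a unit vector; replacing both constants by the larger one lets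
  \<open>x^2 + y^2\<close> factor out.\<close>

lemma sum_power2_le_max:
  fixes a b s t x y :: real
  assumes "0 \<le> s" "0 \<le> t" "s \<le> a * x" "t \<le> b * y" "x\<^sup>2 + y\<^sup>2 = 1" "0 \<le> a" "0 \<le> b"
    "0 \<le> x" "0 \<le> y"
  shows "s\<^sup>2 + t\<^sup>2 \<le> (max a b)\<^sup>2"
proof -
  have "s \<le> max a b * x" "t \<le> max a b * y"
    using assms by (meson max.cobounded1 max.cobounded2 mult_right_mono order_trans)+
  then have "s\<^sup>2 + t\<^sup>2 \<le> (max a b * x)\<^sup>2 + (max a b * y)\<^sup>2"
    using assms by (intro add_mono power_mono)
  also have "\<dots> = (max a b)\<^sup>2 * (x\<^sup>2 + y\<^sup>2)" by (simp add: power_mult_distrib algebra_simps)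
  finally show ?thesis using assms by simp
qed

text \<open>Cauchy-Schwarz in the plane, through the nonnegative square of
  \<open>a * d - b * c\<close>.\<close>

lemma mult_add_mult_le:
  fixes a b c d p q :: real
  assumes "a\<^sup>2 + b\<^sup>2 \<le> p\<^sup>2" "c\<^sup>2 + d\<^sup>2 \<le> q\<^sup>2" "0 \<le> p" "0 \<le> q"
  shows "a * c + b * d \<le> p * q"
proof -
  have "(a * c + b * d)\<^sup>2 \<le> (a\<^sup>2 + b\<^sup>2) * (c\<^sup>2 + d\<^sup>2)"
    using zero_le_power2[of "a * d - b * c"] by (simp add: power2_eq_square algebra_simps)
  also have "\<dots> \<le> p\<^sup>2 * q\<^sup>2" using assms by (intro mult_mono) auto
  finally have "(a * c + b * d)\<^sup>2 \<le> (p * q)\<^sup>2" by (simp add: power_mult_distrib)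
  then show ?thesis by (rule power2_le_imp_le) (use assms in simp)
qed

section \<open>The norm estimate for operator matrices\<close>

theorem theorem3p2:
  fixes A X Y Z W :: "'a::chilbert_space \<Rightarrow> 'a"
    and B :: "'a \<times> 'a \<Rightarrow> 'a \<times> 'a"
  assumes "positive_op A"
    and "B = op_matrix A zero_op zero_op A"
    and "X \<in> A_adjointable A" and "Y \<in> A_adjointable A"
    and "Z \<in> A_adjointable A" and "W \<in> A_adjointable A"
  shows "(A_op_seminorm B (op_matrix X Y Z W))\<^sup>2
    \<le> max ((A_op_seminorm A X)\<^sup>2) ((A_op_seminorm A W)\<^sup>2)
      + max (A_op_seminorm A X) (A_op_seminorm A W) * max (A_op_seminorm A Y) (A_op_seminorm A Z)
      + max ((A_op_seminorm A Y)\<^sup>2) ((A_op_seminorm A Z)\<^sup>2)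
      + A_numerical_radius B
          (op_matrix zero_op (A_sharp A Z \<circ> W) (A_sharp A Y \<circ> X) zero_op)"
proof -
  note pos = assms(1)
  let ?s = "semi_norm A"
  let ?N = "op_matrix zero_op (A_sharp A Z \<circ> W) (A_sharp A Y \<circ> X) zero_op"
  define a where "a = max (A_op_seminorm A X) (A_op_seminorm A W)"
  define b where "b = max (A_op_seminorm A Y) (A_op_seminorm A Z)"
  define w where "w = A_numerical_radius B ?N"
  note nn = A_op_seminorm_nonneg[OF pos]
  note le = semi_norm_le_A_op_seminorm[OF pos]
  note s0 = semi_norm_nonneg[OF pos]
  have a0: "0 \<le> a" and b0: "0 \<le> b" using nn assms by (auto simp: a_def b_def le_max_iff_disj)
  have form: "semi_inner B (?N (x, y)) (x, y) = semi_inner A (X x) (Y y) + semi_inner A (W y) (Z x)"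
    for x y
  proof -
    have "semi_inner A (A_sharp A Y (X x)) y = semi_inner A (X x) (Y y)"
      "semi_inner A (A_sharp A Z (W y)) x = semi_inner A (W y) (Z x)"
      using A_sharp_is_A_adjoint[OF pos assms(4)] A_sharp_is_A_adjoint[OF pos assms(5)]
      \<comment> \<open>The adjoint stands in the first slot here, so Hermitian symmetry is used on
        both sides of the adjoint identity.\<close>
      by (metis is_A_adjoint_def semi_inner_commute[OF pos])+
    then show ?thesis
      by (simp add: assms(2) semi_inner_op_matrix_diag) (simp add: op_matrix_def)
  qed
  have unit: "(?s x)\<^sup>2 + (?s y)\<^sup>2 = 1" if "semi_norm B (x, y) = 1" for x y
    using that semi_norm_op_matrix_diag_power2[OF pos, of "(x, y)"] by (simp add: assms(2))
  have XW: "(?s (X x))\<^sup>2 + (?s (W y))\<^sup>2 \<le> a\<^sup>2" if "semi_norm B (x, y) = 1" for x y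
    unfolding a_def using unit[OF that] nn le s0 assms by (intro sum_power2_le_max) auto
  have YZ: "(?s (Y y))\<^sup>2 + (?s (Z x))\<^sup>2 \<le> b\<^sup>2" if "semi_norm B (x, y) = 1" for x y
    unfolding b_def using unit[OF that] nn le s0 assms
    \<comment> \<open>The components are swapped because \<open>Y\<close> acts on \<open>y\<close>
      and \<open>Z\<close> on \<open>x\<close>.\<close>
    by (intro sum_power2_le_max[where x = "?s y" and y = "?s x"]) auto
  have q: "cmod (semi_inner B (?N (x, y)) (x, y)) \<le> a * b" if "semi_norm B (x, y) = 1" for x y
  proof -
    have "cmod (semi_inner B (?N (x, y)) (x, y)) \<le> ?s (X x) * ?s (Y y) + ?s (W y) * ?s (Z x)"
      unfolding form by (intro norm_triangle_mono cmod_semi_inner_le[OF pos])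
    also have "\<dots> \<le> a * b"
      using mult_add_mult_le[OF XW[OF that] YZ[OF that] a0 b0] .
    finally show ?thesis .
  qed
  \<comment> \<open>The numerical radius bounds its set only if that set is bounded; the
    Cauchy-Schwarz estimate \<open>q\<close> supplies this without constructing an adjoint of the
    matrix.\<close>
  have bdd: "bdd_above (insert 0 {cmod (semi_inner B (?N u) u) | u. semi_norm B u = 1})"
  proof (rule bdd_aboveI)
    fix v assume "v \<in> insert 0 {cmod (semi_inner B (?N u) u) | u. semi_norm B u = 1}"
    then show "v \<le> a * b" using q a0 b0 by fastforce
  qed
  have w0: "0 \<le> w"
    unfolding w_def A_numerical_radius_def by (rule cSup_upper[OF _ bdd]) simp
  have qw: "cmod (semi_inner B (?N u) u) \<le> w" if "semi_norm B u = 1" for u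
    unfolding w_def A_numerical_radius_def using that by (intro cSup_upper[OF _ bdd]) blast
  define r where "r = a\<^sup>2 + a * b + b\<^sup>2 + w"
  have r0: "0 \<le> r" using a0 b0 w0 by (simp add: r_def)
  have main: "semi_norm B (op_matrix X Y Z W u) \<le> sqrt r" if "semi_norm B u = 1" for u
  proof -
    obtain x y where u: "u = (x, y)" by fastforce
    have n: "semi_norm B (x, y) = 1" using that u by simp
    have "(semi_norm B (op_matrix X Y Z W u))\<^sup>2 = (?s (X x + Y y))\<^sup>2 + (?s (W y + Z x))\<^sup>2"
      using semi_norm_op_matrix_diag_power2[OF pos, of "op_matrix X Y Z W u"]
      by (simp add: assms(2) u) (simp add: op_matrix_def add.commute)
    also have "\<dots> = ((?s (X x))\<^sup>2 + (?s (W y))\<^sup>2) + ((?s (Y y))\<^sup>2 + (?s (Z x))\<^sup>2)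
        + 2 * Re (semi_inner B (?N u) u)"
      by (simp add: semi_norm_add_power2[OF pos] form u)
    also have "\<dots> \<le> r"
      using XW[OF n] YZ[OF n] q[OF n] qw[OF n] complex_Re_le_cmod[of "semi_inner B (?N u) u"]
      unfolding r_def u by linarith
    finally show ?thesis by (rule real_le_rsqrt)
  qed
  have "A_op_seminorm B (op_matrix X Y Z W) \<le> sqrt r"
    unfolding A_op_seminorm_def using main r0 by (intro cSup_least) auto
  \<comment> \<open>Nonnegativity allows the inequality with \<open>sqrt r\<close> to be squared;
    \<open>main\<close> also provides the boundedness needed for the supremum.\<close>
  moreover have "0 \<le> A_op_seminorm B (op_matrix X Y Z W)"
    unfolding A_op_seminorm_def using main
    by (intro cSup_upper bdd_aboveI[where M = "sqrt r"]) (auto simp: r0)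
  ultimately have "(A_op_seminorm B (op_matrix X Y Z W))\<^sup>2 \<le> r"
    using r0 by (metis power_mono real_sqrt_pow2)
  then show ?thesis
    using nn assms by (simp add: r_def a_def b_def w_def power2_max)
qed

end
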